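(* Let $(X,d)$ be a compact metric space whose modulus of the doubling condition $\lambda_X$ satisfies \[ \lim_{\delta\to 0^+} \frac{\log \log (e\lambda_X(\delta))}{\log \delta}=0, \] and let $\mu$ be a finite Borel measure on $X$. Then for every $\varepsilon>0$ there exists a closed subset $U\subseteq X$ for which $\mu(X\setminus U)<\varepsilon$ and $U$ (with the restricted metric $d|_U$) is nearly ultrametric.
   Context: Modulus of the doubling condition: for a metric space $(X,d)$ and $\delta>0$, $\lambda_X(\delta)$ is the minimal number $\lambda\in\mathbb N\cup\{\infty\}$ such that any subset of $X$ of diameter at most $\delta$ can be covered by $\lambda$ subsets of diameter at most $\delta/16$. An ultrametric on a set is a metric $\rho$ satisfying $\rho(x,y)\le\max\{\rho(x,z),\rho(y,z)\}$ for all points $x,y,z$. A bounded metric space $(U,d)$ is called nearly ultrametric if there exists an ultrametric $\rho$ on $U$ such that: (i) for every $a,b\in U$, $d(a,b)\le\rho(a,b)$; and (ii) for every $\beta\in(0,1)$ there exists $C>0$ such that $\rho(a,b)\le C\cdot d(a,b)^\beta$ for every $a,b\in U$. *)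

theory Defs
  imports "HOL-Analysis.Analysis" "HOL-Library.Extended_Nat"
begin

text \<open>
  Metric spaces are subsets \<open>X\<close> of a type of class \<open>metric_space\<close>, with the restricted metric.
  The infimum is taken in \<open>enat\<close>, so the modulus is \<open>\<infinity>\<close> if no finite number works.
  Boundedness is required explicitly because \<open>diameter\<close> is unspecified on unbounded sets.
\<close>

definition doubling_modulus :: "'a::metric_space set \<Rightarrow> real \<Rightarrow> enat" where
  "doubling_modulus X \<delta> =
     Inf {enat n | n. \<forall>A\<subseteq>X. bounded A \<and> diameter A \<le> \<delta> \<longrightarrow>
            (\<exists>\<F>. finite \<F> \<and> card \<F> \<le> n \<and> A \<subseteq> \<Union>\<F> \<and>
                 (\<forall>B\<in>\<F>. B \<subseteq> X \<and> bounded B \<and> diameter B \<le> \<delta> / 16))}"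

text \<open>
  On a compact space the modulus is finite at every positive scale,
  so it may be converted to a real number there.
\<close>

lemma doubling_modulus_finite:
  fixes X :: "'a::metric_space set"
  assumes "compact X" and "\<delta> > 0"
  shows "doubling_modulus X \<delta> < \<infinity>"
proof -
  have "\<exists>K. finite K \<and> K \<subseteq> X \<and> X \<subseteq> (\<Union>x\<in>K. ball x (\<delta> / 32))"
    using assms by (intro seq_compact_imp_totally_bounded[rule_format])
      (auto simp: compact_eq_seq_compact_metric)
  then obtain K where K: "finite K" "X \<subseteq> (\<Union>x\<in>K. ball x (\<delta> / 32))"
    by blast
  define \<F> where "\<F> = (\<lambda>x. X \<inter> ball x (\<delta> / 32)) ` K"
  have diam: "diameter (X \<inter> ball x (\<delta> / 32)) \<le> \<delta> / 16" for x
  proof (rule ccontr)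
    assume "\<not> ?thesis"
    then obtain y z where "y \<in> ball x (\<delta> / 32)" "z \<in> ball x (\<delta> / 32)" "\<delta> / 16 < dist y z"
      using diameter_lower_bounded[of "X \<inter> ball x (\<delta> / 32)" "\<delta> / 16"] assms
      by (auto simp: bounded_Int)
    then show False
      using dist_triangle2[of y z x] by (simp add: dist_commute)
  qed
  have "\<F> \<subseteq> Pow X" "finite \<F>" "X \<subseteq> \<Union>\<F>"
    and "\<forall>B\<in>\<F>. B \<subseteq> X \<and> bounded B \<and> diameter B \<le> \<delta> / 16"
    using K diam by (auto simp: \<F>_def intro: bounded_Int)
  then have "enat (card \<F>) \<in> {enat n | n. \<forall>A\<subseteq>X. bounded A \<and> diameter A \<le> \<delta> \<longrightarrow>
            (\<exists>\<F>. finite \<F> \<and> card \<F> \<le> n \<and> A \<subseteq> \<Union>\<F> \<and>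
                 (\<forall>B\<in>\<F>. B \<subseteq> X \<and> bounded B \<and> diameter B \<le> \<delta> / 16))}"
    by (blast intro: order_refl)
  then have "doubling_modulus X \<delta> \<le> enat (card \<F>)"
    unfolding doubling_modulus_def by (rule Inf_lower)
  then show ?thesis
    by (rule order.strict_trans1) simp
qed

definition ultrametric_on :: "'a set \<Rightarrow> ('a \<Rightarrow> 'a \<Rightarrow> real) \<Rightarrow> bool" where
  "ultrametric_on S \<rho> \<longleftrightarrow>
     Metric_space S \<rho> \<and> (\<forall>x\<in>S. \<forall>y\<in>S. \<forall>z\<in>S. \<rho> x y \<le> max (\<rho> x z) (\<rho> y z))"

definition nearly_ultrametric :: "'a::metric_space set \<Rightarrow> bool" where
  "nearly_ultrametric U \<longleftrightarrow>
     bounded U \<and>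
     (\<exists>\<rho>. ultrametric_on U \<rho> \<and>
          (\<forall>a\<in>U. \<forall>b\<in>U. dist a b \<le> \<rho> a b) \<and>
          (\<forall>\<beta>. 0 < \<beta> \<and> \<beta> < 1 \<longrightarrow>
             (\<exists>C>0. \<forall>a\<in>U. \<forall>b\<in>U. \<rho> a b \<le> C * dist a b powr \<beta>)))"

end

theory Submission
  imports Defs "HOL-Real_Asymp.Real_Asymp"
begin

text \<open>
  For each scale \<open>\<delta> n = D / 2 ^ Suc n\<close>, with \<open>D\<close> a bound for the distances in \<open>X\<close>, the space is
  cut, after a small part of it has been thrown away, into finitely many compact clusters of diameter
  at most \<open>\<delta> n\<close> that are mutually at distance at least \<open>t n\<close>. Let \<open>U\<close> be what survives at every
  scale, and for \<open>a \<noteq> b\<close> in \<open>U\<close> put \<open>\<rho> a b = D / 2 ^ n\<close>, where \<open>n\<close> is the first scale at which \<open>a\<close>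
  and \<open>b\<close> lie in different clusters. Then \<open>\<rho>\<close> is an ultrametric whatever the clusters are,
  \<open>dist a b \<le> \<rho> a b\<close> since \<open>a\<close> and \<open>b\<close> share a cluster one scale earlier (or \<open>n = 0\<close>), and
  \<open>\<rho> a b = 2 * \<delta> n\<close> with \<open>t n \<le> dist a b\<close> (lemma \<open>nearly_ultrametric_of_labels\<close>). So it is enough
  that \<open>t n\<close> is not polynomially smaller than \<open>\<delta> n\<close>.

  The clusters come from region growing (lemma \<open>separated_partition\<close>). Let \<open>R\<close> be the part of \<open>X\<close>
  not yet treated and \<open>\<lambda>\<close> the modulus at the scale \<open>\<delta>\<close>. If the centre \<open>x\<close> is chosen in \<open>R\<close> so that
  \<open>\<mu> (R \<inter> cball x (\<delta> / 16))\<close> is almost maximal, then \<open>\<mu> (R \<inter> cball x (\<delta> / 2))\<close> is at most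
  \<open>2 * \<lambda>\<close> times as large, because the bigger ball is covered by \<open>\<lambda>\<close> of the small competitors
  (lemma \<open>heavy_centre\<close>). Hence if the range of radii is divided into \<open>k\<close> steps of width
  \<open>\<delta> / (4 * k)\<close> with \<open>2 * \<lambda> \<le> (1 + \<alpha>) ^ k\<close>, in some step the mass grows at most by the factor
  \<open>1 + \<alpha>\<close>. The ball before that step becomes a cluster, the collar that the step adds is thrown away,
  and the process goes on outside; altogether at most the fraction \<open>\<alpha>\<close> of the mass is lost.

  The losses sum up to less than \<open>\<epsilon>\<close> if \<open>\<alpha> n\<close> is a small multiple of \<open>1 / ((n + 1) * (n + 2))\<close>.
  Some \<open>k n\<close> of the order of \<open>ln (exp 1 * \<lambda>) / \<alpha> n\<close> is then large enough, and the hypothesis on the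
  modulus says that \<open>ln (exp 1 * \<lambda>)\<close> is eventually smaller than every negative power of \<open>\<delta> n\<close>. The
  factor \<open>1 / \<alpha> n\<close> is polynomial in \<open>n\<close>, hence only polylogarithmic in \<open>\<delta> n\<close>, and so \<open>\<delta> n / t n\<close>
  is eventually smaller than every negative power of \<open>\<delta> n\<close> as well.
\<close>

section \<open>Covering by sets of small diameter\<close>

text \<open>
  The modulus is an infimum of extended natural numbers, so once it is finite it is attained and is
  itself an admissible number of covering sets.
\<close>

lemma doubling_cover:
  fixes X :: "'a::metric_space set"
  assumes "compact X" "\<delta> > 0" "A \<subseteq> X" "bounded A" "diameter A \<le> \<delta>"
  shows "\<exists>\<F>. finite \<F> \<and> card \<F> \<le> the_enat (doubling_modulus X \<delta>) \<and> A \<subseteq> \<Union>\<F> \<and>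
               (\<forall>B\<in>\<F>. B \<subseteq> X \<and> bounded B \<and> diameter B \<le> \<delta> / 16)"
proof -
  define S where "S = {enat n | n. \<forall>A\<subseteq>X. bounded A \<and> diameter A \<le> \<delta> \<longrightarrow>
            (\<exists>\<F>. finite \<F> \<and> card \<F> \<le> n \<and> A \<subseteq> \<Union>\<F> \<and>
                 (\<forall>B\<in>\<F>. B \<subseteq> X \<and> bounded B \<and> diameter B \<le> \<delta> / 16))}"
  have mod: "doubling_modulus X \<delta> = Inf S"
    by (simp add: doubling_modulus_def S_def)
  with doubling_modulus_finite[OF assms(1,2)] have "S \<noteq> {}"
    by (auto simp: Inf_enat_def)
  then have "Inf S \<in> S"
    by (auto simp: Inf_enat_def intro: LeastI)
  then have "doubling_modulus X \<delta> \<in> S"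
    by (simp add: mod)
  with assms(3-5) show ?thesis
    unfolding S_def by force
qed

lemma doubling_modulus_ge_1:
  fixes X :: "'a::metric_space set"
  assumes "compact X" "\<delta> > 0" "X \<noteq> {}"
  shows "the_enat (doubling_modulus X \<delta>) \<ge> 1"
proof -
  obtain x where "x \<in> X"
    using assms by blast
  then obtain \<F> where \<F>: "finite \<F>" "card \<F> \<le> the_enat (doubling_modulus X \<delta>)" "{x} \<subseteq> \<Union>\<F>"
    using doubling_cover[OF assms(1,2), of "{x}"] assms(2) by (auto; blast)
  then have "card \<F> > 0"
    by (auto simp: card_gt_0_iff)
  with \<F> show ?thesis
    by linarith
qed

section \<open>Region growing\<close>

lemma measurable_compact_subset:
  fixes X :: "'a::metric_space set"
  assumes "sets M = sets (restrict_space borel X)" "compact C" "C \<subseteq> X"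
  shows "C \<in> sets M"
  using assms by (auto simp: sets_restrict_space image_iff intro!: bexI[of _ C] borel_compact)

text \<open>
  Let \<open>s\<close> be the supremum of the masses of the small balls centred in \<open>R\<close>, and let the small ball
  around \<open>x\<close> have mass at least \<open>s / 2\<close>. The big ball around \<open>x\<close> has diameter at most \<open>\<delta>\<close>, so its
  part in \<open>R\<close> is covered by \<open>\<lambda>\<close> sets of diameter at most \<open>\<delta> / 16\<close>; each of them that meets \<open>R\<close>
  lies in a small ball centred in \<open>R\<close>, of mass at most \<open>s\<close>.
\<close>

lemma heavy_centre:
  fixes X R :: "'a::metric_space set"
  assumes "compact X" "finite_measure M" "sets M = sets (restrict_space borel X)"
    and R: "compact R" "R \<subseteq> X" "R \<noteq> {}" and "\<delta> > 0"
  shows "\<exists>x\<in>R. measure M (R \<inter> cball x (\<delta> / 2))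
       \<le> 2 * real (the_enat (doubling_modulus X \<delta>)) * measure M (R \<inter> cball x (\<delta> / 16))"
proof -
  interpret finite_measure M by fact
  define L where "L = the_enat (doubling_modulus X \<delta>)"
  define m where "m y = measure M (R \<inter> cball y (\<delta> / 16))" for y
  define s where "s = (SUP y\<in>R. m y)"
  have bdd: "bdd_above (m ` R)"
    by (auto simp: m_def intro!: bdd_aboveI[of _ "measure M (space M)"] bounded_measure)
  have m_le: "m y \<le> s" if "y \<in> R" for y
    unfolding s_def using that bdd by (rule cSUP_upper)
  have "\<exists>x\<in>R. s \<le> 2 * m x"
  proof (cases "s \<le> 0")
    case True
    moreover have "0 \<le> m x" for x
      by (simp add: m_def)
    ultimately show ?thesis
      using R(3) by (meson all_not_in_conv mult_nonneg_nonneg order_trans zero_le_numeral)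
  next
    case False
    then obtain x where "x \<in> R" "s / 2 < m x"
      using less_cSUP_iff[OF R(3) bdd, of "s / 2"] unfolding s_def by fastforce
    then show ?thesis
      by (intro bexI[of _ x]) auto
  qed
  then obtain x where x: "x \<in> R" "s \<le> 2 * m x"
    by blast
  define A where "A = R \<inter> cball x (\<delta> / 2)"
  have "dist y z \<le> \<delta>" if "y \<in> A" "z \<in> A" for y z
    using that dist_triangle3[of y z x] by (auto simp: A_def)
  then have "diameter A \<le> \<delta>"
    using \<open>\<delta> > 0\<close> by (auto simp: diameter_def intro!: cSUP_least)
  then obtain \<F> where \<F>: "finite \<F>" "card \<F> \<le> L" "A \<subseteq> \<Union>\<F>"
      "\<And>B. B \<in> \<F> \<Longrightarrow> bounded B \<and> diameter B \<le> \<delta> / 16"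
  proof -
    have "A \<subseteq> X" "bounded A"
      using R(2) by (auto simp: A_def bounded_Int)
    then show ?thesis
      using that doubling_cover[OF assms(1,7) _ _ \<open>diameter A \<le> \<delta>\<close>] unfolding L_def by metis
  qed
  \<comment> \<open>The covering sets need not be measurable; they are replaced by closed balls around points of \<open>R\<close>.\<close>
  define \<G> where "\<G> = {B \<in> \<F>. B \<inter> R \<noteq> {}}"
  have "\<forall>B\<in>\<G>. \<exists>y. y \<in> B \<inter> R"
    by (auto simp: \<G>_def)
  then obtain p where p: "\<And>B. B \<in> \<G> \<Longrightarrow> p B \<in> B \<inter> R"
    by metis
  have meas: "R \<inter> cball y r \<in> sets M" for y r
    using R by (intro measurable_compact_subset[OF assms(3)] compact_Int_closed) auto
  have "measure M A \<le> measure M (\<Union>B\<in>\<G>. R \<inter> cball (p B) (\<delta> / 16))"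
  proof (rule finite_measure_mono)
    show "A \<subseteq> (\<Union>B\<in>\<G>. R \<inter> cball (p B) (\<delta> / 16))"
    proof
      fix y assume "y \<in> A"
      then obtain B where B: "B \<in> \<F>" "y \<in> B" "y \<in> R"
        using \<F>(3) by (auto simp: A_def)
      then have "B \<in> \<G>"
        by (auto simp: \<G>_def)
      moreover have "dist (p B) y \<le> \<delta> / 16"
        using p[OF \<open>B \<in> \<G>\<close>] B \<F>(4)[OF B(1)] diameter_bounded_bound[of B "p B" y] by auto
      ultimately show "y \<in> (\<Union>B\<in>\<G>. R \<inter> cball (p B) (\<delta> / 16))"
        using B by auto
    qed
    show "(\<Union>B\<in>\<G>. R \<inter> cball (p B) (\<delta> / 16)) \<in> sets M"
      using \<F>(1) by (intro sets.finite_UN meas) (simp add: \<G>_def)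
  qed
  also have "\<dots> \<le> (\<Sum>B\<in>\<G>. m (p B))"
    unfolding m_def using \<F>(1) meas
    by (intro finite_measure_subadditive_finite) (auto simp: \<G>_def)
  also have "\<dots> \<le> (\<Sum>B\<in>\<G>. 2 * m x)"
    using p m_le x(2) by (intro sum_mono) (meson IntD2 order_trans)
  also have "\<dots> \<le> real L * (2 * m x)"
  proof -
    have "card \<G> \<le> L"
      using \<F>(1,2) card_mono[of \<F> \<G>] by (auto simp: \<G>_def)
    then show ?thesis
      by (auto simp: m_def intro!: mult_right_mono)
  qed
  finally show ?thesis
    using x(1) by (intro bexI[of _ x]) (simp_all add: A_def m_def L_def mult_ac)
qed

text \<open>
  Otherwise \<open>m\<close> would grow by a factor above \<open>1 + \<alpha>\<close> in each of the \<open>k\<close> steps. The strict inequality of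
  the last step makes the contradiction work when \<open>m 0 = 0\<close> too.
\<close>

lemma slow_growth_step:
  fixes m :: "nat \<Rightarrow> real"
  assumes "m k \<le> c * m 0" "c \<le> (1 + \<alpha>) ^ k" "k \<ge> 1" "\<alpha> \<ge> 0" "m 0 \<ge> 0"
  shows "\<exists>j<k. m (Suc j) \<le> (1 + \<alpha>) * m j"
proof (rule ccontr)
  assume "\<not> ?thesis"
  then have fast: "(1 + \<alpha>) * m j < m (Suc j)" if "j < k" for j
    using that by force
  have low: "(1 + \<alpha>) ^ j * m 0 \<le> m j" if "j \<le> k" for j
    using that
  proof (induction j)
    case (Suc j)
    then have "(1 + \<alpha>) * ((1 + \<alpha>) ^ j * m 0) \<le> (1 + \<alpha>) * m j"
      using assms(4) by (intro mult_left_mono) auto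
    with fast[of j] Suc.prems show ?case
      by (simp add: mult_ac)
  qed simp
  obtain i where i: "k = Suc i"
    using assms(3) by (cases k) auto
  have "c * m 0 \<le> (1 + \<alpha>) * ((1 + \<alpha>) ^ i * m 0)"
    using assms(2,5) i mult_right_mono[of c "(1 + \<alpha>) ^ k" "m 0"] by (simp add: mult_ac)
  also have "\<dots> \<le> (1 + \<alpha>) * m i"
    using assms(4) low[of i] i by (intro mult_left_mono) auto
  also have "\<dots> < m k"
    using fast[of i] i by simp
  finally show False
    using assms(1) by simp
qed

text \<open>
  The clusters are encoded by a map \<open>c\<close> that sends each point to the centre of its cluster. The proof
  is an induction over a finite cover of \<open>R\<close> by balls of radius \<open>\<delta> / 32\<close>: every cluster ball has
  radius at least \<open>\<delta> / 16\<close>, so its removal uses up the covering ball that contains its centre.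
  Removing the closed ball as a cluster, but the open ball of the next radius from \<open>R\<close>, keeps both
  the cluster and the rest compact and leaves a gap of the full width \<open>t\<close> between them.
\<close>

lemma separated_partition:
  fixes X R :: "'a::metric_space set"
  assumes X: "compact X" and fin: "finite_measure M" and sets: "sets M = sets (restrict_space borel X)"
    and \<delta>: "\<delta> > 0" and \<alpha>: "\<alpha> \<ge> 0" and k: "k \<ge> 1"
    and growth: "2 * real (the_enat (doubling_modulus X \<delta>)) \<le> (1 + \<alpha>) ^ k"
    and R: "compact R" "R \<subseteq> X"
  shows "\<exists>U (c :: 'a \<Rightarrow> 'a). compact U \<and> U \<subseteq> R \<and> measure M (R - U) \<le> \<alpha> * measure M U \<and>
    (\<forall>a\<in>U. \<forall>b\<in>U. (c a = c b \<longrightarrow> dist a b \<le> \<delta>) \<and> (c a \<noteq> c b \<longrightarrow> \<delta> / (4 * real k) \<le> dist a b))"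
proof -
  interpret finite_measure M by fact
  have meas: "C \<in> sets M" if "compact C" "C \<subseteq> X" for C
    using that measurable_compact_subset[OF sets] by blast
  \<comment> \<open>The \<open>k\<close> steps lead from the radius \<open>\<delta> / 16\<close> to \<open>5 * \<delta> / 16\<close>, below \<open>\<delta> / 2\<close>.\<close>
  define t where "t = \<delta> / (4 * real k)"
  have t: "t > 0" "real k * t = \<delta> / 4"
    using \<delta> k by (auto simp: t_def field_simps)
  \<comment> \<open>Labels inside \<open>R\<close> guarantee that a new centre, which is removed from \<open>R\<close>, is a new label.\<close>
  define good where "good R U c \<longleftrightarrow>
     compact U \<and> U \<subseteq> R \<and> measure M (R - U) \<le> \<alpha> * measure M U \<and> c ` U \<subseteq> R \<and>
    (\<forall>a\<in>U. \<forall>b\<in>U. (c a = c b \<longrightarrow> dist a b \<le> \<delta>) \<and> (c a \<noteq> c b \<longrightarrow> t \<le> dist a b))"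
    for R U and c :: "'a \<Rightarrow> 'a"
  obtain K where K: "finite K" "X \<subseteq> (\<Union>y\<in>K. ball y (\<delta> / 32))"
    using X \<delta> compactE_image[of X X "\<lambda>y. ball y (\<delta> / 32)"]
    by (smt (verit) UN_I centre_in_ball divide_pos_pos open_ball subsetI)
  have "\<exists>U c. good R U c" if "finite K" "R \<subseteq> (\<Union>y\<in>K. ball y (\<delta> / 32))" "compact R" "R \<subseteq> X" for K R
    using that
  proof (induction K arbitrary: R rule: finite_psubset_induct)
    case (psubset K R)
    show ?case
    proof (cases "R = {}")
      case True
      then show ?thesis
        by (intro exI[of _ "{}"]) (auto simp: good_def)
    next
      case False
      then obtain x where x: "x \<in> R" and heavy:
        "measure M (R \<inter> cball x (\<delta> / 2))
           \<le> 2 * real (the_enat (doubling_modulus X \<delta>)) * measure M (R \<inter> cball x (\<delta> / 16))"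
        using heavy_centre[OF X fin sets psubset.prems(2,3) False \<delta>] by blast
      define r where "r j = \<delta> / 16 + real j * t" for j
      define m where "m j = measure M (R \<inter> cball x (r j))" for j
      have measR: "R \<inter> cball x s \<in> sets M" for s
        using psubset.prems by (intro meas compact_Int_closed) auto
      have r_le: "r j \<le> \<delta> / 2" if "j \<le> k" for j
      proof -
        have "real j * t \<le> real k * t"
          using that t(1) by (intro mult_right_mono) auto
        with t(2) \<delta> show ?thesis
          by (simp add: r_def)
      qed
      have "m k \<le> measure M (R \<inter> cball x (\<delta> / 2))"
        unfolding m_def using r_le[of k] measR by (intro finite_measure_mono) auto
      with heavy have "m k \<le> 2 * real (the_enat (doubling_modulus X \<delta>)) * m 0"
        by (simp add: m_def r_def)
      then obtain j where j: "j < k" "m (Suc j) \<le> (1 + \<alpha>) * m j"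
        using slow_growth_step[OF _ growth k \<alpha>, of m] by (auto simp: m_def)
      define P where "P = R \<inter> cball x (r j)"
      define R' where "R' = R - ball x (r (Suc j))"
      have r_Suc: "r (Suc j) = r j + t"
        by (simp add: r_def algebra_simps)
      have r_ge: "r j \<ge> \<delta> / 16"
        using t by (simp add: r_def)
      obtain y where y: "y \<in> K" "x \<in> ball y (\<delta> / 32)"
        using psubset.prems(1) x by auto
      have "R' \<subseteq> (\<Union>y\<in>K - {y}. ball y (\<delta> / 32))"
      proof
        fix z assume z: "z \<in> R'"
        then obtain y' where y': "y' \<in> K" "z \<in> ball y' (\<delta> / 32)"
          using psubset.prems(1) by (auto simp: R'_def)
        have "y' \<noteq> y"
        proof
          assume "y' = y"
          then have "dist x z < \<delta> / 16"
            using y y' dist_triangle3[of x z y] by simp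
          with z r_ge r_Suc t show False
            by (auto simp: R'_def)
        qed
        with y' show "z \<in> (\<Union>y\<in>K - {y}. ball y (\<delta> / 32))"
          by auto
      qed
      moreover have R': "compact R'" "R' \<subseteq> X"
        using psubset.prems by (auto simp: R'_def intro: compact_diff)
      ultimately obtain U c where U: "good R' U c"
        using psubset.IH[of "K - {y}" R'] y(1) by blast
      define c' where "c' a = (if a \<in> P then x else c a)" for a
      have U': "compact U" "U \<subseteq> R'" "measure M (R' - U) \<le> \<alpha> * measure M U" "c ` U \<subseteq> R'"
        and lab: "\<And>a b. a \<in> U \<Longrightarrow> b \<in> U \<Longrightarrow> (c a = c b \<longrightarrow> dist a b \<le> \<delta>) \<and> (c a \<noteq> c b \<longrightarrow> t \<le> dist a b)"
        using U by (auto simp: good_def)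
      have P: "compact P" "P \<subseteq> R" "P \<subseteq> X"
        using psubset.prems by (auto simp: P_def intro: compact_Int_closed)
      have disj: "P \<inter> R' = {}"
        using t r_Suc by (auto simp: P_def R'_def)
      have sep: "t \<le> dist a b" if "a \<in> P" "b \<in> R'" for a b
        using that r_Suc dist_triangle[of x b a] by (auto simp: P_def R'_def)
      have diamP: "dist a b \<le> \<delta>" if "a \<in> P" "b \<in> P" for a b
        using that r_le[of j] j(1) dist_triangle3[of a b x] by (auto simp: P_def)
      have x_notin: "x \<notin> R'"
        using r_ge r_Suc t \<delta> by (auto simp: R'_def)
      have measU: "U \<in> sets M" "P \<in> sets M" "R' \<in> sets M"
        using U' P R' by (auto intro!: meas)
      have "good R (P \<union> U) c'"
        unfolding good_def
      proof (intro conjI ballI)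
        show "compact (P \<union> U)" "P \<union> U \<subseteq> R"
          using U' P by (auto simp: R'_def intro: compact_Un)
        show "c' ` (P \<union> U) \<subseteq> R"
          using U' x by (auto simp: c'_def R'_def)
        define collar where "collar = R \<inter> cball x (r (Suc j)) - P"
        have "measure M collar = m (Suc j) - m j"
          unfolding collar_def m_def P_def using measR r_Suc t by (intro finite_measure_Diff) auto
        also have "\<dots> \<le> \<alpha> * measure M P"
          using j(2) by (simp add: m_def P_def algebra_simps)
        finally have collar: "measure M collar \<le> \<alpha> * measure M P" .
        have "measure M (R - (P \<union> U)) \<le> measure M (collar \<union> (R' - U))"
          using measU measR by (intro finite_measure_mono) (auto simp: collar_def R'_def)
        also have "\<dots> \<le> measure M collar + measure M (R' - U)"
          using measU measR by (intro measure_Un_le) (auto simp: collar_def)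
        also have "\<dots> \<le> \<alpha> * (measure M P + measure M U)"
          using collar U'(3) by (simp add: algebra_simps)
        also have "measure M P + measure M U = measure M (P \<union> U)"
          using measU disj U'(2) by (intro finite_measure_Union[symmetric]) auto
        finally show "measure M (R - (P \<union> U)) \<le> \<alpha> * measure M (P \<union> U)" .
      next
        fix a b assume ab: "a \<in> P \<union> U" "b \<in> P \<union> U"
        have ne: "c z \<noteq> x" if "z \<in> U" for z
          using that U'(4) x_notin by auto
        show "c' a = c' b \<longrightarrow> dist a b \<le> \<delta>"
          using ab lab[of a b] diamP[of a b] ne[of a] ne[of b] by (auto simp: c'_def)
        show "c' a \<noteq> c' b \<longrightarrow> t \<le> dist a b"
          using ab lab[of a b] sep[of a b] sep[of b a] U'(2) by (auto simp: c'_def dist_commute)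
      qed
      then show ?thesis
        by blast
    qed
  qed
  then have "\<exists>U c. good R U c"
    using K R by (meson order_trans)
  then show ?thesis
    unfolding good_def t_def by blast
qed

section \<open>From separated partitions to an ultrametric\<close>

text \<open>
  With \<open>N a b\<close> the first \<open>n\<close> at which the labels of \<open>a\<close> and \<open>b\<close> differ, two points that \<open>c n\<close>
  separates cannot both have the same label as a third one, so \<open>N x y\<close> is at least the minimum of
  \<open>N x z\<close> and \<open>N y z\<close>. For decreasing \<open>w\<close> this is the ultrametric inequality for \<open>w (N x y)\<close>.
  The index shift in \<open>close\<close> reflects that points first
  separated at \<open>Suc n\<close> still agree at \<open>n\<close>.
\<close>

lemma nearly_ultrametric_of_labels:
  fixes U :: "'a::metric_space set" and c :: "nat \<Rightarrow> 'a \<Rightarrow> 'b" and w t :: "nat \<Rightarrow> real"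
  assumes "bounded U" and w: "decseq w" "w \<longlonglongrightarrow> 0" "\<And>n. w n > 0"
    and diam: "\<And>a b. a \<in> U \<Longrightarrow> b \<in> U \<Longrightarrow> dist a b \<le> w 0"
    and close: "\<And>n a b. a \<in> U \<Longrightarrow> b \<in> U \<Longrightarrow> c n a = c n b \<Longrightarrow> dist a b \<le> w (Suc n)"
    and sep: "\<And>n a b. a \<in> U \<Longrightarrow> b \<in> U \<Longrightarrow> c n a \<noteq> c n b \<Longrightarrow> t n \<le> dist a b"
    and t: "\<And>n. t n > 0"
    and comparable: "\<And>\<beta>. 0 < \<beta> \<Longrightarrow> \<beta> < 1 \<Longrightarrow> \<exists>C>0. \<forall>n. w n \<le> C * t n powr \<beta>"
  shows "nearly_ultrametric U"
proof -
  define N where "N a b = (LEAST n. c n a \<noteq> c n b)" for a b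
  define \<rho> where "\<rho> a b = (if a = b then 0 else w (N a b))" for a b
  have N: "c (N a b) a \<noteq> c (N a b) b" if ab: "a \<in> U" "b \<in> U" "a \<noteq> b" for a b
  proof -
    have "\<forall>\<^sub>F n in sequentially. w n < dist a b"
      using w(2) ab(3) by (intro order_tendstoD) auto
    then obtain n where "w (Suc n) < dist a b"
      by (meson eventually_sequentially le_SucI order_refl)
    with close[OF ab(1,2), of n] have "c n a \<noteq> c n b"
      by force
    then show ?thesis
      unfolding N_def by (rule LeastI)
  qed
  have N_le: "N a b \<le> n" if "c n a \<noteq> c n b" for a b n
    unfolding N_def using that by (rule Least_le)
  have N_sym: "N a b = N b a" for a b
    by (simp add: N_def eq_commute)
  have le: "dist a b \<le> \<rho> a b" if ab: "a \<in> U" "b \<in> U" for a b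
  proof (cases "a = b \<or> N a b = 0")
    case True
    then show ?thesis
      using diam[OF ab] by (auto simp: \<rho>_def)
  next
    case False
    then obtain n where n: "N a b = Suc n"
      by (cases "N a b") auto
    then have "c n a = c n b"
      using N_le[of n a b] by force
    with close[OF ab this] n False show ?thesis
      by (simp add: \<rho>_def)
  qed
  have ultra: "\<rho> x y \<le> max (\<rho> x z) (\<rho> y z)" if "x \<in> U" "y \<in> U" "z \<in> U" for x y z
  proof (cases "x = y \<or> x = z \<or> y = z")
    case True
    then show ?thesis
      using w(3)[of "N x z"] by (auto simp: \<rho>_def N_sym less_imp_le[OF w(3)])
  next
    case False
    then have "c (N x y) x \<noteq> c (N x y) z \<or> c (N x y) y \<noteq> c (N x y) z"
      using N[of x y] that by metis
    then have "w (N x y) \<le> w (N x z) \<or> w (N x y) \<le> w (N y z)"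
      using N_le decseqD[OF w(1)] by metis
    with False show ?thesis
      by (auto simp: \<rho>_def)
  qed
  have nonneg: "0 \<le> \<rho> x y" for x y
    using w(3)[of "N x y"] by (simp add: \<rho>_def)
  have "Metric_space U \<rho>"
  proof
    show "0 \<le> \<rho> x y" for x y
      by (rule nonneg)
    show "\<rho> x y = \<rho> y x" for x y
      by (simp add: \<rho>_def N_sym)
    show "\<rho> x y = 0 \<longleftrightarrow> x = y" for x y
      using w(3)[of "N x y"] by (simp add: \<rho>_def)
    show "\<rho> x z \<le> \<rho> x y + \<rho> y z" if "x \<in> U" "y \<in> U" "z \<in> U" for x y z
    proof -
      have "\<rho> x z \<le> max (\<rho> x y) (\<rho> z y)"
        using ultra that by blast
      also have "\<dots> \<le> \<rho> x y + \<rho> y z"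
        using nonneg[of x y] nonneg[of y z] \<open>\<And>y x. \<rho> x y = \<rho> y x\<close>[of z y] by simp
      finally show ?thesis .
    qed
  qed
  moreover have "\<exists>C>0. \<forall>a\<in>U. \<forall>b\<in>U. \<rho> a b \<le> C * dist a b powr \<beta>" if \<beta>: "0 < \<beta>" "\<beta> < 1" for \<beta>
  proof -
    obtain C where C: "C > 0" "\<And>n. w n \<le> C * t n powr \<beta>"
      using comparable[OF \<beta>] by blast
    have "\<rho> a b \<le> C * dist a b powr \<beta>" if ab: "a \<in> U" "b \<in> U" for a b
    proof (cases "a = b")
      case False
      have "w (N a b) \<le> C * t (N a b) powr \<beta>"
        by (rule C(2))
      also have "\<dots> \<le> C * dist a b powr \<beta>"
        using C(1) sep[OF ab N[OF ab False]] t[of "N a b"] \<beta>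
        by (intro mult_left_mono powr_mono2) auto
      finally show ?thesis
        using False by (simp add: \<rho>_def)
    qed (simp add: \<rho>_def)
    with C(1) show ?thesis
      by blast
  qed
  ultimately show ?thesis
    unfolding nearly_ultrametric_def ultrametric_on_def
    using assms(1) le ultra by blast
qed

section \<open>Choice of scales\<close>

text \<open>
  This undoes the double logarithm; the sign is the delicate point, as \<open>ln \<delta>\<close> is negative near 0.
\<close>

lemma ln_subpolynomial:
  fixes L :: "real \<Rightarrow> real"
  assumes lim: "((\<lambda>\<delta>. ln (ln (exp 1 * L \<delta>)) / ln \<delta>) \<longlongrightarrow> 0) (at_right 0)"
    and L: "\<And>\<delta>. \<delta> > 0 \<Longrightarrow> L \<delta> \<ge> 1" and "\<eta> > 0"
  shows "\<forall>\<^sub>F \<delta> in at_right 0. ln (exp 1 * L \<delta>) \<le> \<delta> powr - \<eta>"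
proof -
  have "\<forall>\<^sub>F \<delta> in at_right 0. - \<eta> < ln (ln (exp 1 * L \<delta>)) / ln \<delta>"
    using lim assms(3) by (intro order_tendstoD) auto
  moreover have "\<forall>\<^sub>F \<delta>::real in at_right 0. 0 < \<delta> \<and> \<delta> < 1"
    by (auto simp: eventually_at_right_field intro!: exI[of _ 1])
  ultimately show ?thesis
  proof eventually_elim
    case (elim \<delta>)
    then have neg: "ln \<delta> < 0" and pos: "L \<delta> \<ge> 1"
      using L by auto
    have "ln (ln (exp 1 * L \<delta>)) \<le> - \<eta> * ln \<delta>"
      using elim(1) neg by (simp add: field_simps)
    moreover have "ln (exp 1 * L \<delta>) > 0"
      using pos by (simp add: ln_mult add_pos_nonneg)
    ultimately have "ln (exp 1 * L \<delta>) \<le> exp (- \<eta> * ln \<delta>)"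
      by (metis exp_le_cancel_iff exp_ln)
    with elim show ?case
      by (simp add: powr_def)
  qed
qed

text \<open>
  This determines how many growth steps are needed: \<open>ln (1 + \<alpha>) \<ge> \<alpha> / 2\<close> for \<open>\<alpha> \<le> 1\<close>, and the
  constant \<open>exp 1\<close> under the logarithm absorbs the factor \<open>2\<close>.
\<close>

lemma power_ge_double:
  fixes \<alpha> l :: real
  assumes "0 < \<alpha>" "\<alpha> \<le> 1" "l \<ge> 1" "2 * ln (exp 1 * l) / \<alpha> \<le> real k"
  shows "2 * l \<le> (1 + \<alpha>) ^ k"
proof -
  have "\<alpha> / 2 \<le> ln (1 + \<alpha>)"
  proof -
    have "- ln (1 + \<alpha>) \<le> inverse (1 + \<alpha>) - 1"
      using ln_le_minus_one[of "inverse (1 + \<alpha>)"] assms by (simp add: ln_inverse)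
    also have "inverse (1 + \<alpha>) - 1 = - (\<alpha> / (1 + \<alpha>))"
      using assms by (simp add: field_simps)
    also have "\<dots> \<le> - (\<alpha> / 2)"
      using assms by (simp add: field_simps)
    finally show ?thesis
      by linarith
  qed
  then have "real k * (\<alpha> / 2) \<le> real k * ln (1 + \<alpha>)"
    by (intro mult_left_mono) auto
  moreover have "ln (exp 1 * l) \<le> real k * (\<alpha> / 2)"
    using assms by (simp add: field_simps)
  ultimately have "exp (ln (exp 1 * l)) \<le> exp (real k * ln (1 + \<alpha>))"
    by simp
  then have "exp 1 * l \<le> (1 + \<alpha>) ^ k"
    using assms by (simp add: exp_of_nat_mult)
  moreover have "2 * l \<le> exp 1 * l"
    using exp_ge_add_one_self[of 1] assms by (intro mult_right_mono) auto
  ultimately show ?thesis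
    by linarith
qed

text \<open>
  Take \<open>\<eta> = (1 - \<beta>) / \<beta>\<close>. Then \<open>\<delta> powr (1 / \<beta>) = \<delta> * \<delta> powr \<eta> \<le> K * t\<close>, and raising this to the
  power \<open>\<beta>\<close> gives the claim.
\<close>

lemma scale_le_gap_powr:
  fixes \<delta> t q :: "nat \<Rightarrow> real"
  assumes \<delta>: "\<And>n. \<delta> n > 0" and t: "\<And>n. t n > 0" and q: "\<And>n. \<delta> n = q n * t n"
    and q_bound: "\<And>\<eta>. \<eta> > 0 \<Longrightarrow> \<exists>K>0. \<forall>n. q n * \<delta> n powr \<eta> \<le> K"
    and \<beta>: "0 < \<beta>" "\<beta> < 1"
  shows "\<exists>C>0. \<forall>n. \<delta> n \<le> C * t n powr \<beta>"
proof -
  define \<eta> where "\<eta> = (1 - \<beta>) / \<beta>"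
  have "\<eta> > 0"
    using \<beta> by (simp add: \<eta>_def)
  then obtain K where K: "K > 0" "\<And>n. q n * \<delta> n powr \<eta> \<le> K"
    using q_bound by blast
  have "\<delta> n \<le> K powr \<beta> * t n powr \<beta>" for n
  proof -
    have "1 / \<beta> = 1 + \<eta>"
      using \<beta> by (simp add: \<eta>_def field_simps)
    then have "\<delta> n powr (1 / \<beta>) = \<delta> n * \<delta> n powr \<eta>"
      using \<delta>[of n] by (simp add: powr_add)
    also have "\<dots> = q n * \<delta> n powr \<eta> * t n"
      using q[of n] by (metis mult.assoc mult.commute)
    also have "\<dots> \<le> K * t n"
      using K(2) t[of n] by (intro mult_right_mono) auto
    finally have "(\<delta> n powr (1 / \<beta>)) powr \<beta> \<le> (K * t n) powr \<beta>"
      using \<beta> by (intro powr_mono2) auto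
    then show ?thesis
      using \<beta> \<delta>[of n] K(1) t[of n] by (simp add: powr_powr powr_mult)
  qed
  with K(1) show ?thesis
    by (intro exI[of _ "K powr \<beta>"]) simp
qed

theorem theorem14:
  fixes X :: "'a::metric_space set" and \<mu> :: "'a measure"
  assumes "compact X"
    and "((\<lambda>\<delta>::real. ln (ln (exp 1 * real (the_enat (doubling_modulus X \<delta>)))) / ln \<delta>)
            \<longlongrightarrow> 0) (at_right 0)"
    and "finite_measure \<mu>"
    and "sets \<mu> = sets (restrict_space borel X)"
  shows "\<forall>\<epsilon>>0. \<exists>U. closedin (top_of_set X) U \<and> measure \<mu> (X - U) < \<epsilon> \<and> nearly_ultrametric U"
proof (cases "X = {}")
  case True
  have "nearly_ultrametric ({} :: 'a set)"
    unfolding nearly_ultrametric_def ultrametric_on_def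
    by (auto intro!: exI[of _ dist] exI[of _ "1::real"] simp: Metric_space_def dist_commute)
  with True show ?thesis
    by auto
next
  case ne: False
  interpret finite_measure \<mu> by fact
  have space: "space \<mu> = X"
    using sets_eq_imp_space_eq[OF assms(4)] by (simp add: space_restrict_space)
  show ?thesis
  proof (intro allI impI)
    fix \<epsilon> :: real assume \<epsilon>: "\<epsilon> > 0"
    define L where "L \<delta> = real (the_enat (doubling_modulus X \<delta>))" for \<delta>
    have L: "L \<delta> \<ge> 1" if "\<delta> > 0" for \<delta>
      using doubling_modulus_ge_1[OF assms(1) that ne] by (simp add: L_def)
    obtain D where D: "D > 0" "\<And>a b. a \<in> X \<Longrightarrow> b \<in> X \<Longrightarrow> dist a b \<le> D"
    proof
      show "diameter X + 1 > 0"
        using diameter_ge_0[OF compact_imp_bounded[OF assms(1)]] by simp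
      show "dist a b \<le> diameter X + 1" if "a \<in> X" "b \<in> X" for a b
        using diameter_bounded_bound[OF compact_imp_bounded[OF assms(1)] that] by simp
    qed
    define w where "w n = D / 2 ^ n" for n
    define \<delta> where "\<delta> n = w (Suc n)" for n
    \<comment> \<open>The \<open>\<alpha> n\<close> sum to \<open>e\<close>, and \<open>e * measure \<mu> X < \<epsilon>\<close>; the cap at 1 gives \<open>\<alpha> n \<le> 1\<close>.\<close>
    define e where "e = min 1 (\<epsilon> / (2 * (measure \<mu> X + 1)))"
    define \<alpha> where "\<alpha> n = e / (real (n + 1) * real (n + 2))" for n
    define k where "k n = nat \<lceil>2 * ln (exp 1 * L (\<delta> n)) / \<alpha> n\<rceil>" for n
    define t where "t n = \<delta> n / (4 * real (k n))" for n
    have w: "w n > 0" for n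
      using D by (simp add: w_def)
    have \<delta>: "\<delta> n > 0" for n
      by (simp add: \<delta>_def w)
    have e: "0 < e" "e \<le> 1" "e * measure \<mu> X < \<epsilon>"
    proof -
      show "0 < e" "e \<le> 1"
        using \<epsilon> by (simp_all add: e_def add_nonneg_pos)
      have "e * measure \<mu> X \<le> \<epsilon> / (2 * (measure \<mu> X + 1)) * measure \<mu> X"
        by (intro mult_right_mono) (auto simp: e_def)
      also have "\<dots> = \<epsilon> * (measure \<mu> X / (2 * (measure \<mu> X + 1)))"
        by simp
      also have "\<dots> < \<epsilon> * 1"
        using \<epsilon> measure_nonneg[of \<mu> X] by (intro mult_strict_left_mono) (simp_all add: divide_less_eq add_nonneg_pos)
      finally show "e * measure \<mu> X < \<epsilon>"
        by simp
    qed
    have \<alpha>: "0 < \<alpha> n" "\<alpha> n \<le> 1" for n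
    proof -
      show "0 < \<alpha> n"
        using e by (simp add: \<alpha>_def)
      have "1 \<le> real (n + 1) * real (n + 2)"
        using mult_mono[of 1 "real (n + 1)" 1 "real (n + 2)"] by simp
      then show "\<alpha> n \<le> 1"
        using e unfolding \<alpha>_def by (subst divide_le_eq_1_pos) auto
    qed
    have lnL: "ln (exp 1 * L (\<delta> n)) \<ge> 1" for n
      using L[OF \<delta>, of n] by (simp add: ln_mult)
    have k_ge: "2 * ln (exp 1 * L (\<delta> n)) / \<alpha> n \<le> real (k n)" for n
      unfolding k_def by (rule real_nat_ceiling_ge)
    have quot: "1 \<le> ln (exp 1 * L (\<delta> n)) / \<alpha> n" for n
      using lnL[of n] \<alpha>[of n] by (simp add: le_divide_eq)
    have k1: "k n \<ge> 1" for n
      using k_ge[of n] quot[of n] by simp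
    have k_le: "real (k n) \<le> 3 * ln (exp 1 * L (\<delta> n)) / \<alpha> n" for n
    proof -
      have "real (k n) \<le> 2 * ln (exp 1 * L (\<delta> n)) / \<alpha> n + 1"
        using quot[of n] unfolding k_def by linarith
      with quot[of n] show ?thesis
        by simp
    qed
    have t: "t n > 0" for n
      using \<delta>[of n] k1[of n] by (simp add: t_def)
    have \<delta>_lim: "filterlim \<delta> (at_right 0) sequentially"
    proof -
      have "((\<lambda>n. D / 2 ^ Suc n) \<longlonglongrightarrow> 0)"
        by real_asymp
      then show ?thesis
        using \<delta> D(1) by (simp add: filterlim_at \<delta>_def[abs_def] w_def eventually_sequentially)
    qed
    have ratio: "\<exists>K>0. \<forall>n. 4 * real (k n) * \<delta> n powr \<eta> \<le> K" if \<eta>: "\<eta> > 0" for \<eta>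
    proof -
      \<comment> \<open>Half of \<open>\<eta>\<close> pays for the modulus, the other half for the quadratic factor in \<open>1 / \<alpha> n\<close>.\<close>
      have "\<forall>\<^sub>F n in sequentially. ln (exp 1 * L (\<delta> n)) \<le> \<delta> n powr - (\<eta> / 2)"
        using ln_subpolynomial[of L "\<eta> / 2"] assms(2) L \<eta> \<delta>_lim
        by (auto simp: L_def filterlim_iff)
      moreover have "(\<lambda>n. real (n + 1) * real (n + 2) * \<delta> n powr (\<eta> / 2)) \<longlonglongrightarrow> 0"
        unfolding \<delta>_def w_def using D(1) \<eta> by real_asymp
      then have "\<forall>\<^sub>F n in sequentially. real (n + 1) * real (n + 2) * \<delta> n powr (\<eta> / 2) < 1"
        by (rule order_tendstoD) simp
      ultimately have "\<forall>\<^sub>F n in sequentially. real (k n) * \<delta> n powr \<eta> \<le> 3 / e"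
      proof eventually_elim
        case (elim n)
        have "real (k n) * \<delta> n powr \<eta> \<le> 3 * \<delta> n powr - (\<eta> / 2) / \<alpha> n * \<delta> n powr \<eta>"
          using k_le[of n] elim(1) \<alpha>[of n]
          by (intro mult_right_mono order_trans[OF k_le] divide_right_mono mult_left_mono) auto
        also have "\<dots> = 3 / \<alpha> n * (\<delta> n powr - (\<eta> / 2) * \<delta> n powr \<eta>)"
          by simp
        also have "\<delta> n powr - (\<eta> / 2) * \<delta> n powr \<eta> = \<delta> n powr (\<eta> / 2)"
          by (simp flip: powr_add)
        also have "3 / \<alpha> n * \<delta> n powr (\<eta> / 2)
            = 3 / e * (real (n + 1) * real (n + 2) * \<delta> n powr (\<eta> / 2))"
          by (simp add: \<alpha>_def)
        also have "\<dots> \<le> 3 / e * 1"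
          using elim(2) e by (intro mult_left_mono) auto
        finally show ?case
          by simp
      qed
      then have "Bseq (\<lambda>n. real (k n) * \<delta> n powr \<eta>)"
        by (intro BfunI[of _ "3 / e"]) simp
      then obtain K where K: "K > 0" "\<And>n. norm (real (k n) * \<delta> n powr \<eta>) \<le> K"
        by (auto simp: Bseq_def)
      have "4 * real (k n) * \<delta> n powr \<eta> \<le> 4 * K" for n
        using K(2)[of n] by simp
      with K(1) show ?thesis
        by (intro exI[of _ "4 * K"]) simp
    qed
    have "\<forall>n. \<exists>U (c :: 'a \<Rightarrow> 'a). compact U \<and> U \<subseteq> X \<and> measure \<mu> (X - U) \<le> \<alpha> n * measure \<mu> X \<and>
      (\<forall>a\<in>U. \<forall>b\<in>U. (c a = c b \<longrightarrow> dist a b \<le> \<delta> n) \<and> (c a \<noteq> c b \<longrightarrow> t n \<le> dist a b))"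
    proof
      fix n
      have "2 * L (\<delta> n) \<le> (1 + \<alpha> n) ^ k n"
        using \<alpha> L[OF \<delta>] k_ge by (rule power_ge_double)
      then obtain U and c :: "'a \<Rightarrow> 'a" where U: "compact U" "U \<subseteq> X"
        "measure \<mu> (X - U) \<le> \<alpha> n * measure \<mu> U"
        "\<forall>a\<in>U. \<forall>b\<in>U. (c a = c b \<longrightarrow> dist a b \<le> \<delta> n) \<and> (c a \<noteq> c b \<longrightarrow> t n \<le> dist a b)"
        using separated_partition[OF assms(1,3,4) \<delta>[of n] _ k1[of n], of "\<alpha> n" X] \<alpha>[of n] assms(1)
        unfolding L_def t_def by auto
      have "\<alpha> n * measure \<mu> U \<le> \<alpha> n * measure \<mu> X"
        using \<alpha>(1)[of n] bounded_measure[of U] by (intro mult_left_mono) (auto simp: space)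
      with U show "\<exists>U (c :: 'a \<Rightarrow> 'a). compact U \<and> U \<subseteq> X \<and> measure \<mu> (X - U) \<le> \<alpha> n * measure \<mu> X \<and>
        (\<forall>a\<in>U. \<forall>b\<in>U. (c a = c b \<longrightarrow> dist a b \<le> \<delta> n) \<and> (c a \<noteq> c b \<longrightarrow> t n \<le> dist a b))"
        by (meson order_trans)
    qed
    then obtain U and c :: "nat \<Rightarrow> 'a \<Rightarrow> 'a" where
      U: "\<And>n. compact (U n)" "\<And>n. U n \<subseteq> X" "\<And>n. measure \<mu> (X - U n) \<le> \<alpha> n * measure \<mu> X"
      and lab: "\<And>n a b. a \<in> U n \<Longrightarrow> b \<in> U n \<Longrightarrow>
        (c n a = c n b \<longrightarrow> dist a b \<le> \<delta> n) \<and> (c n a \<noteq> c n b \<longrightarrow> t n \<le> dist a b)"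
      by metis
    define V where "V = (\<Inter>n. U n)"
    have VX: "V \<subseteq> X"
      using U(2) by (auto simp: V_def)
    have "closed V"
      unfolding V_def using U(1) by (intro closed_INT) (auto intro: compact_imp_closed)
    then have closed: "closedin (top_of_set X) V"
      using VX by (simp add: closed_subset)
    have sums: "\<alpha> sums e"
    proof -
      have "(\<lambda>n. e * (1 / real (n + 1) - 1 / real (Suc n + 1))) sums (e * (1 / real (0 + 1) - 0))"
        by (intro sums_mult telescope_sums') real_asymp
      moreover have "e * (1 / real (n + 1) - 1 / real (Suc n + 1)) = \<alpha> n" for n
        by (simp add: \<alpha>_def field_simps)
      ultimately show ?thesis
        by simp
    qed
    have small: "measure \<mu> (X - V) < \<epsilon>"
    proof -
      have meas: "X - U n \<in> sets \<mu>" for n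
        using measurable_compact_subset[OF assms(4)] U(1,2)[of n] assms(1) by auto
      have sumX: "(\<lambda>n. \<alpha> n * measure \<mu> X) sums (e * measure \<mu> X)"
        using sums by (rule sums_mult2)
      have summ: "summable (\<lambda>n. measure \<mu> (X - U n))"
        using sumX U(3) by (intro summable_comparison_test'[OF sums_summable, OF sumX]) auto
      have "measure \<mu> (X - V) = measure \<mu> (\<Union>n. X - U n)"
        by (simp add: V_def)
      also have "\<dots> \<le> (\<Sum>n. measure \<mu> (X - U n))"
        using meas summ by (intro finite_measure_subadditive_countably) auto
      also have "\<dots> \<le> (\<Sum>n. \<alpha> n * measure \<mu> X)"
        using U(3) summ sums_summable[OF sumX] by (intro suminf_le) auto
      also have "\<dots> < \<epsilon>"
        using sums_unique[OF sumX] e(3) by simp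
      finally show ?thesis .
    qed
    have "nearly_ultrametric V"
    proof (rule nearly_ultrametric_of_labels[where w = w and t = t and c = c])
      show "bounded V"
        using VX compact_imp_bounded[OF assms(1)] by (rule bounded_subset[rotated])
      show "decseq w"
        using D(1) by (auto simp: decseq_def w_def intro!: divide_left_mono power_increasing)
      show "w \<longlonglongrightarrow> 0"
        unfolding w_def by real_asymp
      show "dist a b \<le> w 0" if "a \<in> V" "b \<in> V" for a b
        using that VX D(2) by (auto simp: w_def)
      show "dist a b \<le> w (Suc n)" if "a \<in> V" "b \<in> V" "c n a = c n b" for n a b
        using that lab[of a n b] by (auto simp: V_def \<delta>_def)
      show "t n \<le> dist a b" if "a \<in> V" "b \<in> V" "c n a \<noteq> c n b" for n a b
        using that lab[of a n b] by (auto simp: V_def)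
      show "\<exists>C>0. \<forall>n. w n \<le> C * t n powr \<beta>" if \<beta>: "0 < \<beta>" "\<beta> < 1" for \<beta>
      proof -
        have "\<delta> n = 4 * real (k n) * t n" for n
          using k1[of n] by (simp add: t_def)
        from scale_le_gap_powr[of \<delta> t "\<lambda>n. 4 * real (k n)", OF \<delta> t this ratio \<beta>]
        obtain C where C: "C > 0" "\<And>n. \<delta> n \<le> C * t n powr \<beta>"
          by blast
        have "w n \<le> (2 * C) * t n powr \<beta>" for n
          using C(2)[of n] by (simp add: \<delta>_def w_def)
        with C(1) show ?thesis
          by (intro exI[of _ "2 * C"]) simp
      qed
    qed (use w t in auto)
    with closed small show "\<exists>U. closedin (top_of_set X) U \<and> measure \<mu> (X - U) < \<epsilon> \<and> nearly_ultrametric U"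
      by blast
  qed
qed

end
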